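(* Let $x=\sum_{j=1}^N\lambda_jV_j\in\mathbb{R}^d$ where $V\in\mathbb{R}^{d\times N}$ has columns $V_1,\ldots,V_N$ and $\lambda\in\mathbb{R}^N$ satisfies $\mathbf{1}^{\top}\lambda=1$, $\lambda\ge0$. Let $\varepsilon>0$ and write $R=\max\{R_v,R_\lambda\}$ where $R_v=\max_i\|\lambda_iV_i\|_\infty$ and $R_\lambda=\max_i|\lambda_i|$. Then there exist a subset $\mathcal{J}\subset\{1,\ldots,N\}$ of size $$|\mathcal{J}|=\min\left\{N,\ \left\lceil 1+N\,\frac{2\log(4d)\,(\sqrt{N}R/\varepsilon)^2}{1+2\log(4d)\,(\sqrt{N}R/\varepsilon)^2}\right\rceil\right\}$$ and coefficients $\mu_j\ge0$, $j\in\mathcal{J}$, such that $\hat{x}=\sum_{j\in\mathcal{J}}\mu_jV_j$ satisfies $$\|x-\hat{x}\|_\infty\le\varepsilon\qquad\text{and}\qquad\left|\sum_{j\in\mathcal{J}}\mu_j-1\right|\le\varepsilon.$$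
   Context: $\log$ is the natural logarithm, and $\lceil\cdot\rceil$ denotes the ceiling. *)

theory Defs
  imports "HOL-Analysis.Analysis"
begin

end

theory Submission
  imports Defs "HOL-Probability.Hoeffding"
begin

text \<open>
  The theorem is Serfling's inequality for sampling without replacement, together with a union
  bound: for a uniformly random set \<open>J\<close> of \<open>m\<close> among \<open>N\<close> indices, the rescaled sums
  \<open>(N/m) \<Sum>\<^sub>J \<lambda>\<^sub>j V\<^sub>j\<close> and \<open>(N/m) \<Sum>\<^sub>J \<lambda>\<^sub>j\<close> approximate \<open>x\<close> and \<open>1\<close>. That is
  \<open>d + 1\<close> scalar averages, each of numbers of absolute value at most \<open>R\<close>, to be kept within
  \<open>\<epsilon>/N\<close> of the full average on both sides, hence \<open>2(d + 1) \<le> 4d\<close> one-sided constraints.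

  The proof is a derandomised form of the martingale argument, so that no random sets are needed.
  Start with all \<open>N\<close> indices and delete them one by one, watching the potential
  \<open>\<Sum>\<^sub>c exp (s (mean\<^sub>J w\<^sub>c - mean w\<^sub>c))\<close> over all constraints \<open>c\<close>. Deleting a uniformly random
  element of a set of size \<open>k + 1\<close> preserves its mean in expectation and moves it by
  \<open>(mean\<^sub>J w - w\<^sub>i)/k\<close>, a variable of range \<open>2R/k\<close>. By Hoeffding's lemma the expected
  potential grows by a factor of at most \<open>exp (s\<^sup>2 R\<^sup>2 / (2 k\<^sup>2))\<close>, so some deletion achieves
  this (\<open>exists_good_deletion\<close>). As \<open>1/k\<^sup>2 \<le> 1/(k-1) - 1/k\<close>, the accumulated exponents
  telescope to \<open>B = 1/(m-1) - 1/(N-1)\<close> times \<open>s\<^sup>2 R\<^sup>2 / 2\<close> (\<open>exists_subset_exp_moment\<close>).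
  The final potential dominates each of its terms, and the usual Chernoff choice of \<open>s\<close> bounds
  every deviation by \<open>\<epsilon>/N\<close> provided \<open>2 ln (4d) R\<^sup>2 B \<le> (\<epsilon>/N)\<^sup>2\<close>
  (\<open>exists_subset_means_close\<close>). With \<open>A = 2 ln (4d) N R\<^sup>2/\<epsilon>\<^sup>2\<close> this condition reads
  \<open>A N B \<le> 1\<close>, and it holds as soon as \<open>m \<ge> 1 + N A/(1 + A)\<close>
  (\<open>sample_size_suffices\<close>). If that size is at least \<open>N\<close>, all indices may be kept with the
  original coefficients.
\<close>

section \<open>Means and the deletion of one element\<close>

definition mean :: "('i \<Rightarrow> real) \<Rightarrow> 'i set \<Rightarrow> real" where
  "mean f J = (\<Sum>i\<in>J. f i) / real (card J)"

lemma mean_remove: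
  assumes "finite J" "i \<in> J" "card J \<ge> 2"
  shows "mean f (J - {i}) = mean f J + (mean f J - f i) / (real (card J) - 1)"
proof -
  have "real (card J) > 1" "real (card (J - {i})) = real (card J) - 1"
    using assms by (auto simp: card_Diff_singleton of_nat_diff)
  moreover have "(\<Sum>j\<in>J - {i}. f j) = (\<Sum>j\<in>J. f j) - f i"
    using assms by (simp add: sum_diff1)
  ultimately show ?thesis
    unfolding mean_def by (simp add: divide_simps) (simp add: algebra_simps)
qed

text \<open>
  Hoeffding's lemma for the uniform distribution on \<open>J\<close>, applied to \<open>- f\<close>, whose values lie in
  an interval of length \<open>2R\<close>: the general constant \<open>(2R)\<^sup>2/8\<close> becomes \<open>R\<^sup>2/2\<close>.
\<close>

lemma Hoeffding_mean:
  fixes f :: "'i \<Rightarrow> real"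
  assumes "finite J" "J \<noteq> {}" "\<And>i. i \<in> J \<Longrightarrow> \<bar>f i\<bar> \<le> R" "s > 0"
  shows "(\<Sum>i\<in>J. exp (s * (mean f J - f i))) \<le> real (card J) * exp (s\<^sup>2 * R\<^sup>2 / 2)"
proof -
  let ?M = "measure_pmf (pmf_of_set J)"
  have card: "real (card J) > 0"
    using assms by (simp add: card_gt_0_iff)
  interpret interval_bounded_random_variable ?M "\<lambda>i. - f i" "- R" R
    by unfold_locales
       (use assms in \<open>auto simp: AE_measure_pmf_iff abs_le_iff minus_le_iff\<close>)
  have E: "measure_pmf.expectation (pmf_of_set J) (\<lambda>i. - f i) = - mean f J"
    using integral_pmf_of_set[OF \<open>J \<noteq> {}\<close> \<open>finite J\<close>, of "\<lambda>i. - f i"]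
    by (simp only: mean_def sum_negf minus_divide_left)
  have "(\<integral>\<^sup>+i. exp (s * (- f i - - mean f J)) \<partial>?M) \<le> ennreal (exp (s\<^sup>2 * (R - - R)\<^sup>2 / 8))"
    using Hoeffdings_lemma_nn_integral[OF \<open>s > 0\<close>] unfolding E .
  also have "(\<integral>\<^sup>+i. exp (s * (- f i - - mean f J)) \<partial>?M)
      = ennreal ((\<Sum>i\<in>J. exp (s * (mean f J - f i))) / real (card J))"
    using assms card
    by (simp add: nn_integral_pmf_of_set sum_ennreal divide_ennreal sum_nonneg
          ennreal_of_nat_eq_real_of_nat)
  also have "(R - - R)\<^sup>2 / 8 = R\<^sup>2 / 2"
    by (simp add: power2_eq_square)
  hence "s\<^sup>2 * (R - - R)\<^sup>2 / 8 = s\<^sup>2 * R\<^sup>2 / 2"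
    by (metis times_divide_eq_right)
  finally show ?thesis
    using card by (simp add: ennreal_le_iff divide_simps mult.commute)
qed

text \<open>
  If every deletion increased the potential by more than the stated factor, then so would the
  average over all deletions. But that average factors for each \<open>c\<close> into the old term and a moment
  to which \<open>Hoeffding_mean\<close> applies with \<open>s / (card J - 1)\<close> in place of \<open>s\<close>.
\<close>

lemma exists_good_deletion:
  fixes w :: "'c \<Rightarrow> 'i \<Rightarrow> real" and a :: "'c \<Rightarrow> real"
  assumes "finite J" "card J \<ge> 2" "s > 0"
    and "\<And>c i. c \<in> C \<Longrightarrow> i \<in> J \<Longrightarrow> \<bar>w c i\<bar> \<le> R"
  shows "\<exists>i\<in>J. (\<Sum>c\<in>C. exp (s * (mean (w c) (J - {i}) - a c)))
    \<le> exp (s\<^sup>2 * R\<^sup>2 / 2 * (1 / (real (card J) - 1)\<^sup>2)) * (\<Sum>c\<in>C. exp (s * (mean (w c) J - a c)))"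
    (is "\<exists>i\<in>J. ?F i \<le> ?K * ?G")
proof (rule ccontr)
  assume "\<not> ?thesis"
  hence less: "\<And>i. i \<in> J \<Longrightarrow> ?K * ?G < ?F i"
    by force
  have "J \<noteq> {}" using assms by auto
  let ?k = "real (card J) - 1"
  have k: "?k > 0" using assms by simp
  have "real (card J) * (?K * ?G) < (\<Sum>i\<in>J. ?F i)"
    using sum_strict_mono[OF \<open>finite J\<close> \<open>J \<noteq> {}\<close> less] by simp
  also have "\<dots> = (\<Sum>c\<in>C. exp (s * (mean (w c) J - a c)) *
      (\<Sum>i\<in>J. exp (s / ?k * (mean (w c) J - w c i))))"
    unfolding sum_distrib_left
    by (subst sum.swap)
       (use assms in \<open>auto intro!: sum.cong
          simp: mean_remove algebra_simps diff_divide_distrib simp flip: exp_add\<close>)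
  also have "\<dots> \<le> (\<Sum>c\<in>C. exp (s * (mean (w c) J - a c)) *
      (real (card J) * exp ((s / ?k)\<^sup>2 * R\<^sup>2 / 2)))"
    using assms k \<open>J \<noteq> {}\<close> by (intro sum_mono mult_left_mono Hoeffding_mean) auto
  also have "\<dots> = real (card J) * (?K * ?G)"
    by (simp add: sum_distrib_left sum_distrib_right power_divide mult_ac)
  finally show False by simp
qed

section \<open>Subsets with simultaneously small deviations\<close>

text \<open>
  Deletions are iterated from \<open>S\<close> down to size \<open>m\<close>. The bound \<open>1 / (m - 1) - 1 / (card S - 1)\<close>
  is a telescoping majorant of \<open>\<Sum>k=m..<card S. 1/k\<^sup>2\<close>, the sum of the successive
  exponents up to the factor \<open>s\<^sup>2 R\<^sup>2 / 2\<close>; the last term is worth keeping, because it is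
  what makes the error vanish as \<open>m\<close> approaches \<open>card S\<close>.
\<close>

lemma exists_subset_exp_moment:
  fixes w :: "'c \<Rightarrow> 'i \<Rightarrow> real"
  assumes "finite S" "2 \<le> m" "m \<le> card S" "s > 0"
    and bound: "\<And>c i. c \<in> C \<Longrightarrow> i \<in> S \<Longrightarrow> \<bar>w c i\<bar> \<le> R"
  shows "\<exists>J\<subseteq>S. card J = m \<and> (\<Sum>c\<in>C. exp (s * (mean (w c) J - mean (w c) S)))
    \<le> exp (s\<^sup>2 * R\<^sup>2 / 2 * (1 / (real m - 1) - 1 / (real (card S) - 1))) * real (card C)"
  using assms(3,2)
proof (induction m rule: inc_induct)
  case base
  show ?case by (intro exI[of _ S]) simp
next
  case (step k)
  from step obtain J where J: "J \<subseteq> S" "card J = Suc k"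
    "(\<Sum>c\<in>C. exp (s * (mean (w c) J - mean (w c) S)))
      \<le> exp (s\<^sup>2 * R\<^sup>2 / 2 * (1 / real k - 1 / (real (card S) - 1))) * real (card C)"
    by force
  have "finite J" using J \<open>finite S\<close> finite_subset by blast
  have "\<bar>w c i\<bar> \<le> R" if "c \<in> C" "i \<in> J" for c i
    using that J bound by blast
  with exists_good_deletion[of J s C w R "\<lambda>c. mean (w c) S"] \<open>finite J\<close> J step \<open>s > 0\<close>
  obtain i where i: "i \<in> J" "(\<Sum>c\<in>C. exp (s * (mean (w c) (J - {i}) - mean (w c) S)))
    \<le> exp (s\<^sup>2 * R\<^sup>2 / 2 * (1 / (real k)\<^sup>2)) * (\<Sum>c\<in>C. exp (s * (mean (w c) J - mean (w c) S)))"
    by auto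
  have k: "real k \<ge> 2" using step by simp
  note i(2)
  also have "exp (s\<^sup>2 * R\<^sup>2 / 2 * (1 / (real k)\<^sup>2)) * (\<Sum>c\<in>C. exp (s * (mean (w c) J - mean (w c) S)))
    \<le> exp (s\<^sup>2 * R\<^sup>2 / 2 * (1 / (real k)\<^sup>2)) *
      (exp (s\<^sup>2 * R\<^sup>2 / 2 * (1 / real k - 1 / (real (card S) - 1))) * real (card C))"
    using J(3) by (intro mult_left_mono) auto
  also have "\<dots> = exp (s\<^sup>2 * R\<^sup>2 / 2 * (1 / (real k)\<^sup>2 +
      (1 / real k - 1 / (real (card S) - 1)))) * real (card C)"
    by (simp only: distrib_left exp_add mult.assoc)
  also have "\<dots> \<le> exp (s\<^sup>2 * R\<^sup>2 / 2 * (1 / (real k - 1) - 1 / (real (card S) - 1))) * real (card C)"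
  proof -
    have "1 / (real k)\<^sup>2 + 1 / real k \<le> 1 / (real k - 1)"
      using k by (simp add: field_simps power2_eq_square)
    thus ?thesis
      by (intro mult_right_mono) (auto intro!: mult_left_mono)
  qed
  finally have "(\<Sum>c\<in>C. exp (s * (mean (w c) (J - {i}) - mean (w c) S))) \<le> \<dots>" .
  moreover have "card (J - {i}) = k" using i J by simp
  ultimately show ?case using J by blast
qed

text \<open>
  A deterministic Serfling-type inequality. The two signs of the deviation are treated as separate
  constraints, which is why \<open>L\<close> has to dominate \<open>2 * card C\<close>.
\<close>

lemma exists_subset_means_close:
  fixes w :: "'c \<Rightarrow> 'i \<Rightarrow> real"
  assumes "finite S" "finite C" "2 \<le> m" "m < card S" "t > 0" "R > 0"
    and bound: "\<And>c i. c \<in> C \<Longrightarrow> i \<in> S \<Longrightarrow> \<bar>w c i\<bar> \<le> R"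
    and L: "2 * real (card C) \<le> L"
    and t: "2 * ln L * R\<^sup>2 * (1 / (real m - 1) - 1 / (real (card S) - 1)) \<le> t\<^sup>2"
  shows "\<exists>J\<subseteq>S. card J = m \<and> (\<forall>c\<in>C. \<bar>mean (w c) J - mean (w c) S\<bar> \<le> t)"
proof (cases "C = {}")
  case True
  then show ?thesis
    using obtain_subset_with_card_n[of m S] assms(4) by (metis empty_iff less_imp_le)
next
  case False
  define B where "B = 1 / (real m - 1) - 1 / (real (card S) - 1)"
  have B: "B > 0"
    using assms by (simp add: B_def frac_less2)
  have RB: "R\<^sup>2 * B > 0" using B \<open>R > 0\<close> by simp
  \<comment> \<open>This minimises \<open>s\<^sup>2 R\<^sup>2 B / 2 - s t\<close>, the exponent in the Chernoff bound.\<close>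
  define s where "s = t / (R\<^sup>2 * B)"
  have s: "s > 0" using RB \<open>t > 0\<close> by (simp add: s_def)
  have "card C > 0" using False \<open>finite C\<close> by (simp add: card_gt_0_iff)
  hence "L > 0" using L by linarith
  let ?w = "\<lambda>(c, \<sigma>) i. \<sigma> * w c i"
  let ?C = "C \<times> {1, -1 :: real}"
  obtain J where J: "J \<subseteq> S" "card J = m" "(\<Sum>c\<in>?C. exp (s * (mean (?w c) J - mean (?w c) S)))
    \<le> exp (s\<^sup>2 * R\<^sup>2 / 2 * B) * real (card ?C)"
    using exists_subset_exp_moment[of S m s ?C ?w R] assms s unfolding B_def
    by (force simp: case_prod_beta)
  have *: "\<sigma> * (mean (w c) J - mean (w c) S) \<le> t" if "c \<in> C" "\<sigma> \<in> {1, -1}" for c \<sigma>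
  proof -
    have "mean (?w (c, \<sigma>)) A = \<sigma> * mean (w c) A" for A
      by (simp add: mean_def sum_distrib_left)
    hence "exp (s * (\<sigma> * (mean (w c) J - mean (w c) S)))
        = exp (s * (mean (?w (c, \<sigma>)) J - mean (?w (c, \<sigma>)) S))"
      by (simp add: algebra_simps)
    also have "\<dots> \<le> (\<Sum>c\<in>?C. exp (s * (mean (?w c) J - mean (?w c) S)))"
      using that \<open>finite C\<close>
      by (intro member_le_sum[of "(c, \<sigma>)" ?C "\<lambda>c. exp (s * (mean (?w c) J - mean (?w c) S))"]) auto
    also have "\<dots> \<le> exp (s\<^sup>2 * R\<^sup>2 / 2 * B) * L"
      using J(3) L by (auto simp: card_cartesian_product mult.commute elim!: order_trans)
    also have "\<dots> = exp (s\<^sup>2 * R\<^sup>2 / 2 * B + ln L)"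
      using \<open>L > 0\<close> by (simp add: exp_add)
    also have "\<dots> \<le> exp (s * t)"
    proof -
      have "s\<^sup>2 * R\<^sup>2 / 2 * B = t\<^sup>2 / (2 * (R\<^sup>2 * B))"
        using \<open>R > 0\<close> B by (simp add: s_def power2_eq_square)
      moreover have "ln L \<le> t\<^sup>2 / (2 * (R\<^sup>2 * B))"
        using t RB by (simp add: B_def[symmetric] pos_le_divide_eq mult_ac)
      moreover have "s * t = 2 * (t\<^sup>2 / (2 * (R\<^sup>2 * B)))"
        by (simp add: s_def power2_eq_square)
      ultimately show ?thesis by simp
    qed
    finally show ?thesis using s by simp
  qed
  have "\<bar>mean (w c) J - mean (w c) S\<bar> \<le> t" if "c \<in> C" for c
    using *[OF that, of 1] *[OF that, of "-1"] by simp
  with J show ?thesis by blast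
qed

section \<open>Sparse approximation of convex combinations\<close>

lemma infnorm_cart_le:
  fixes y :: "real ^ 'd"
  assumes "\<And>k. \<bar>y $ k\<bar> \<le> e"
  shows "infnorm y \<le> e"
  unfolding infnorm_cart using assms by (intro cSup_least) auto

text \<open>
  The hypothesis says \<open>A N \<le> (1 + A)(m - 1)\<close>, so the first reciprocal contributes at most
  \<open>1 + A\<close>; the second one takes off at least \<open>A\<close> because \<open>N > N - 1\<close>. The extra \<open>1 +\<close> in the
  prescribed sample size is thus exactly what pays for the \<open>m - 1\<close> of the telescoping bound.
\<close>

lemma sample_size_suffices:
  fixes A N m :: real
  assumes "1 + N * (A / (1 + A)) \<le> m" "A > 0" "1 < N"
  shows "A * N * (1 / (m - 1) - 1 / (N - 1)) \<le> 1"
proof -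
  have "N * (A / (1 + A)) > 0" using assms by simp
  hence m: "m - 1 > 0" using assms by linarith
  have "A * N \<le> (1 + A) * (m - 1)"
    using assms by (simp add: field_simps)
  hence "A * N * (1 / (m - 1)) \<le> 1 + A"
    using m by (simp add: field_simps)
  moreover have "A * N * (1 / (N - 1)) \<ge> A"
    using assms by (simp add: field_simps)
  ultimately show ?thesis by (simp only: right_diff_distrib)
qed

theorem theorem6p2:
  fixes V :: "real ^ 'N ^ 'd"
    and lam :: "real ^ 'N"
    and x :: "real ^ 'd"
    and \<epsilon> R R\<^sub>v R\<^sub>l :: real
  assumes x: "x = (\<Sum>j\<in>UNIV. lam $ j *\<^sub>R column j V)"
    and lam_sum: "(\<Sum>j\<in>UNIV. lam $ j) = 1"
    and lam_nonneg: "\<And>j. lam $ j \<ge> 0"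
    and eps: "\<epsilon> > 0"
    and R\<^sub>v: "R\<^sub>v = Max (range (\<lambda>i. infnorm (lam $ i *\<^sub>R column i V)))"
    and R\<^sub>l: "R\<^sub>l = Max (range (\<lambda>i. \<bar>lam $ i\<bar>))"
    and R: "R = max R\<^sub>v R\<^sub>l"
  shows "\<exists>(J :: 'N set) (\<mu> :: 'N \<Rightarrow> real).
      int (card J) = min (int CARD('N))
        \<lceil>1 + real CARD('N) *
            (2 * ln (4 * real CARD('d)) * (sqrt (real CARD('N)) * R / \<epsilon>)\<^sup>2
              / (1 + 2 * ln (4 * real CARD('d)) * (sqrt (real CARD('N)) * R / \<epsilon>)\<^sup>2))\<rceil> \<and>
      (\<forall>j\<in>J. \<mu> j \<ge> 0) \<and>
      infnorm (x - (\<Sum>j\<in>J. \<mu> j *\<^sub>R column j V)) \<le> \<epsilon> \<and>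
      \<bar>(\<Sum>j\<in>J. \<mu> j) - 1\<bar> \<le> \<epsilon>"
proof -
  define N where "N = CARD('N)"
  define A where "A = 2 * ln (4 * real CARD('d)) * (sqrt (real N) * R / \<epsilon>)\<^sup>2"
  define M where "M = \<lceil>1 + real N * (A / (1 + A))\<rceil>"
  let ?goal = "\<lambda>J \<mu>. int (card J) = min (int N) M \<and> (\<forall>j\<in>J. \<mu> j \<ge> 0) \<and>
      infnorm (x - (\<Sum>j\<in>J. \<mu> j *\<^sub>R column j V)) \<le> \<epsilon> \<and> \<bar>(\<Sum>j\<in>J. \<mu> j) - 1\<bar> \<le> \<epsilon>"
  have N: "N > 0" by (simp add: N_def)
  have d: "real CARD('d) \<ge> 1" by (simp add: Suc_leI)
  have lam_le: "\<bar>lam $ i\<bar> \<le> R" for i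
    using Max_ge[of "range (\<lambda>i. \<bar>lam $ i\<bar>)" "\<bar>lam $ i\<bar>"] by (simp add: R R\<^sub>l le_max_iff_disj)
  have V_le: "\<bar>lam $ i * V $ k $ i\<bar> \<le> R" for i k
  proof -
    have "\<bar>lam $ i * V $ k $ i\<bar> \<le> infnorm (lam $ i *\<^sub>R column i V)"
      using component_le_infnorm_cart[of "lam $ i *\<^sub>R column i V" k] by (simp add: column_def)
    also have "\<dots> \<le> R"
      using Max_ge[of "range (\<lambda>i. infnorm (lam $ i *\<^sub>R column i V))"] by (simp add: R R\<^sub>v le_max_iff_disj)
    finally show ?thesis .
  qed
  have Rpos: "R > 0"
  proof (rule ccontr)
    assume "\<not> R > 0"
    hence "lam $ i = 0" for i using lam_le[of i] by simp
    thus False using lam_sum by simp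
  qed
  have lnpos: "ln (4 * real CARD('d)) > 0"
    using d by (intro ln_gt_zero) linarith
  have A: "A > 0"
    using lnpos Rpos eps N by (simp add: A_def)
  have "\<exists>J \<mu>. ?goal J \<mu>"
  proof (cases "int N \<le> M")
    case True
    have "?goal UNIV (\<lambda>j. lam $ j)"
      using True lam_nonneg lam_sum eps by (simp add: x N_def infnorm_0)
    thus ?thesis by blast
  next
    case False
    have pos: "real N * (A / (1 + A)) > 0" using A N by simp
    define m where "m = nat M"
    have "M > 1" using pos by (simp add: M_def less_ceiling_iff)
    hence m: "int m = M" "2 \<le> m" "m < N"
      using False by (auto simp: m_def)
    have mge: "1 + real N * (A / (1 + A)) \<le> real m"
      using m(1) unfolding M_def by linarith
    \<comment> \<open>The coordinates of the vectors \<open>(\<lambda>\<^sub>i V\<^sub>i, \<lambda>\<^sub>i)\<close> in dimension \<open>d + 1\<close>: the extra coordinate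
      \<open>None\<close> controls the sum of the new coefficients.\<close>
    let ?w = "\<lambda>c i. case c of None \<Rightarrow> lam $ i | Some k \<Rightarrow> lam $ i * V $ k $ i"
    have "\<bar>?w c i\<bar> \<le> R" for c i
      using lam_le V_le by (cases c) auto
    moreover have "2 * real (card (UNIV :: 'd option set)) \<le> 4 * real CARD('d)"
      using d by (simp add: card_UNIV_option)
    moreover have "2 * ln (4 * real CARD('d)) * R\<^sup>2 * (1 / (real m - 1) - 1 / (real N - 1)) \<le> (\<epsilon> / N)\<^sup>2"
    proof -
      have "2 * ln (4 * real CARD('d)) * R\<^sup>2 = A * N * (\<epsilon> / N)\<^sup>2"
        using eps N by (simp add: A_def power_mult_distrib power_divide)
          (simp add: power2_eq_square)
      hence "2 * ln (4 * real CARD('d)) * R\<^sup>2 * (1 / (real m - 1) - 1 / (real N - 1))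
          = (A * N * (1 / (real m - 1) - 1 / (real N - 1))) * (\<epsilon> / N)\<^sup>2"
        by simp
      also have "\<dots> \<le> 1 * (\<epsilon> / N)\<^sup>2"
        using m by (intro mult_right_mono sample_size_suffices mge A) auto
      finally show ?thesis by simp
    qed
    ultimately obtain J where J: "card J = m" "\<And>c. \<bar>mean (?w c) J - mean (?w c) UNIV\<bar> \<le> \<epsilon> / N"
      using exists_subset_means_close[of UNIV UNIV m "\<epsilon> / N" R ?w "4 * real CARD('d)"] m eps N Rpos
      by (auto simp: N_def)
    define \<mu> where "\<mu> = (\<lambda>j. real N / real m * lam $ j)"
    have scale: "\<bar>(\<Sum>j\<in>J. real N / real m * ?w c j) - (\<Sum>j\<in>UNIV. ?w c j)\<bar> \<le> \<epsilon>" for c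
    proof -
      have "(\<Sum>j\<in>J. real N / real m * ?w c j) - (\<Sum>j\<in>UNIV. ?w c j)
          = real N * (mean (?w c) J - mean (?w c) UNIV)"
        using J(1) N by (simp add: mean_def N_def[symmetric] right_diff_distrib
              sum_distrib_left sum_divide_distrib)
      also have "\<bar>\<dots>\<bar> \<le> \<epsilon>"
        using J(2)[of c] N by (simp add: abs_mult pos_le_divide_eq mult.commute)
      finally show ?thesis .
    qed
    have "infnorm (x - (\<Sum>j\<in>J. \<mu> j *\<^sub>R column j V)) \<le> \<epsilon>"
      using scale[of "Some _"]
      by (intro infnorm_cart_le) (simp add: x \<mu>_def column_def abs_minus_commute mult.assoc)
    moreover have "\<bar>(\<Sum>j\<in>J. \<mu> j) - 1\<bar> \<le> \<epsilon>"
      using scale[of None] lam_sum by (simp add: \<mu>_def)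
    moreover have "\<forall>j\<in>J. \<mu> j \<ge> 0" by (simp add: \<mu>_def lam_nonneg)
    ultimately have "?goal J \<mu>" using J(1) m False by simp
    thus ?thesis by blast
  qed
  thus ?thesis unfolding A_def M_def N_def .
qed

end
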